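(* Let $G$ be an amenable group, and let $\mu$ be a finitely additive left invariant probability mean on $G^2$. Then $\mu(\operatorname{Comm}(G))>0$ if and only if $G$ is finite-by-abelian-by-finite.
   Context: A finitely additive left invariant probability mean on a group $K$ is a function $\mu\colon\mathcal{P}(K)\to[0,1]$ with $\mu(K)=1$, $\mu(A\sqcup B)=\mu(A)+\mu(B)$ for disjoint $A,B\subseteq K$, and $\mu(kA)=\mu(A)$ for all $k\in K$, $A\subseteq K$. A group is amenable if it admits such a mean. $G^2=G\times G$ and $\operatorname{Comm}(G)=\{(g,h)\in G^2: gh=hg\}$. A group $G$ is finite-by-abelian-by-finite if it has a normal subgroup $H$ of finite index such that $H$ has a finite normal subgroup $N$ with $H/N$ abelian (equivalently, $G$ has a finite normal subgroup $N$ such that $G/N$ has a finite index abelian normal subgroup). *)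

theory Defs
  imports Complex_Main "HOL-Algebra.Algebra"
begin

text \<open>The set functions below have type \<open>'a set \<Rightarrow> real\<close>; only their values on subsets of the
  carrier are constrained.\<close>

definition left_invariant_mean :: "('a, 'm) monoid_scheme \<Rightarrow> ('a set \<Rightarrow> real) \<Rightarrow> bool" where
  "left_invariant_mean K \<mu> \<longleftrightarrow>
     (\<forall>A. A \<subseteq> carrier K \<longrightarrow> 0 \<le> \<mu> A \<and> \<mu> A \<le> 1) \<and>
     \<mu> (carrier K) = 1 \<and>
     (\<forall>A B. A \<subseteq> carrier K \<longrightarrow> B \<subseteq> carrier K \<longrightarrow> A \<inter> B = {} \<longrightarrow> \<mu> (A \<union> B) = \<mu> A + \<mu> B) \<and>
     (\<forall>k A. k \<in> carrier K \<longrightarrow> A \<subseteq> carrier K \<longrightarrow> \<mu> (k <#\<^bsub>K\<^esub> A) = \<mu> A)"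

definition amenable :: "('a, 'm) monoid_scheme \<Rightarrow> bool" where
  "amenable K \<longleftrightarrow> (\<exists>\<mu>. left_invariant_mean K \<mu>)"

definition Comm :: "('a, 'm) monoid_scheme \<Rightarrow> ('a \<times> 'a) set" where
  "Comm G = {(g, h). g \<in> carrier G \<and> h \<in> carrier G \<and> g \<otimes>\<^bsub>G\<^esub> h = h \<otimes>\<^bsub>G\<^esub> g}"

definition finite_by_abelian_by_finite :: "('a, 'm) monoid_scheme \<Rightarrow> bool" where
  "finite_by_abelian_by_finite G \<longleftrightarrow>
     (\<exists>H. H \<lhd> G \<and> finite (rcosets\<^bsub>G\<^esub> H) \<and>
       (\<exists>N. N \<lhd> G\<lparr>carrier := H\<rparr> \<and> finite N \<and> comm_group (G\<lparr>carrier := H\<rparr> Mod N)))"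

end

theory Submission
  imports Defs
begin

text \<open>
  Suppose \<open>\<mu> (Comm G) = \<alpha> > 0\<close>. The translates of \<open>Comm G\<close> by \<open>(inv f, 1)\<close> all have mean \<open>\<alpha>\<close>, and
  those for \<open>f\<close> and \<open>f'\<close> meet inside \<open>G \<times> C(f f'\<inverse>)\<close>. Hence among any \<open>n\<close> elements, with \<open>n \<alpha> \<ge> 2\<close>,
  there are two for which \<open>C(f f'\<inverse>)\<close> has index bounded in terms of \<open>\<alpha>\<close>. A maximal set without such
  pairs shows that the FC-centre has finite index and conjugacy classes of bounded size, so its
  derived subgroup is finite by B. H. Neumann's theorem.

  Conversely, if \<open>H\<close> has finitely many commutators, choose a finite set \<open>E\<close> realizing all of them; its
  centralizer \<open>L\<close> has finite index. For \<open>c, d \<in> L\<close> some \<open>e, e' \<in> E\<close> make \<open>e c\<close> and \<open>e' d\<close> commute, as the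
  commutator of \<open>e\<close> and \<open>e'\<close> can be chosen to cancel that of \<open>c\<close> and \<open>d\<close>. So finitely many translates of
  \<open>Comm G\<close> cover \<open>G \<times> G\<close>.
\<close>

section \<open>Conjugacy classes of bounded size\<close>

context group
begin

definition conj_class :: "'a \<Rightarrow> 'a set" where
  "conj_class x = (\<lambda>g. g \<otimes> x \<otimes> inv g) ` carrier G"

lemma inv_mult_cancel:
  assumes "x \<in> carrier G" "y \<in> carrier G"
  shows "inv x \<otimes> (x \<otimes> y) = y" "x \<otimes> (inv x \<otimes> y) = y"
  using assms by (simp_all flip: m_assoc)

text \<open>These rules right-associate words, push inverses onto the letters and cancel adjacent
  inverse pairs, so \<open>simp\<close> settles identities that hold in free groups.\<close>

lemmas group_word_simps = m_assoc inv_mult_group inv_mult_cancel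

text \<open>Orbit-stabilizer for conjugation: the fibres of g -> g x g^-1 are the left cosets of the
  centralizer of x. This links class sizes with indices of centralizers.\<close>

lemma conj_eq_iff:
  assumes "g \<in> carrier G" "h \<in> carrier G" "x \<in> carrier G"
  shows "g \<otimes> x \<otimes> inv g = h \<otimes> x \<otimes> inv h \<longleftrightarrow> (inv h \<otimes> g) \<otimes> x = x \<otimes> (inv h \<otimes> g)"
proof -
  have "g \<otimes> x \<otimes> inv g = h \<otimes> x \<otimes> inv h \<longleftrightarrow> inv h \<otimes> (g \<otimes> x \<otimes> inv g) \<otimes> g = inv h \<otimes> (h \<otimes> x \<otimes> inv h) \<otimes> g"
    using assms by (metis inv_closed l_cancel m_closed r_cancel)
  then show ?thesis using assms by (simp add: group_word_simps)
qed

lemma conj_class_closed: "x \<in> carrier G \<Longrightarrow> conj_class x \<subseteq> carrier G"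
  by (auto simp: conj_class_def)

lemma conj_class_mult:
  assumes "x \<in> carrier G" "y \<in> carrier G"
  shows "conj_class (x \<otimes> y) \<subseteq> (\<lambda>(a, b). a \<otimes> b) ` (conj_class x \<times> conj_class y)"
proof
  fix z assume "z \<in> conj_class (x \<otimes> y)"
  then obtain g where g: "g \<in> carrier G" "z = g \<otimes> (x \<otimes> y) \<otimes> inv g"
    by (auto simp: conj_class_def)
  then have "z = (g \<otimes> x \<otimes> inv g) \<otimes> (g \<otimes> y \<otimes> inv g)"
    using assms by (simp add: group_word_simps)
  then show "z \<in> (\<lambda>(a, b). a \<otimes> b) ` (conj_class x \<times> conj_class y)"
    using g by (auto simp: conj_class_def)
qed

lemma conj_class_mult_bound:
  assumes "x \<in> carrier G" "y \<in> carrier G" "finite (conj_class x)" "finite (conj_class y)"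
  shows "finite (conj_class (x \<otimes> y))"
    and "card (conj_class (x \<otimes> y)) \<le> card (conj_class x) * card (conj_class y)"
proof -
  note fin = finite_cartesian_product[OF assms(3,4)]
  show "finite (conj_class (x \<otimes> y))"
    using conj_class_mult[OF assms(1,2)] fin by (meson finite_imageI finite_subset)
  have "card (conj_class (x \<otimes> y)) \<le> card ((\<lambda>(a, b). a \<otimes> b) ` (conj_class x \<times> conj_class y))"
    by (rule card_mono[OF finite_imageI[OF fin] conj_class_mult[OF assms(1,2)]])
  also have "\<dots> \<le> card (conj_class x \<times> conj_class y)"
    by (rule card_image_le[OF fin])
  finally show "card (conj_class (x \<otimes> y)) \<le> card (conj_class x) * card (conj_class y)"
    by (simp add: card_cartesian_product)
qed

lemma conj_class_inv:
  assumes "x \<in> carrier G"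
  shows "conj_class (inv x) = m_inv G ` conj_class x"
proof -
  have "g \<otimes> inv x \<otimes> inv g = inv (g \<otimes> x \<otimes> inv g)" if "g \<in> carrier G" for g
    using assms that by (simp add: group_word_simps)
  then show ?thesis by (auto simp: conj_class_def image_image)
qed

lemma card_conj_class_inv:
  assumes "x \<in> carrier G"
  shows "card (conj_class (inv x)) = card (conj_class x)"
  unfolding conj_class_inv[OF assms]
  by (rule card_image, rule inj_on_subset[OF inv_inj conj_class_closed[OF assms]])

lemma conj_class_conj:
  assumes "x \<in> carrier G" "g \<in> carrier G"
  shows "conj_class (g \<otimes> x \<otimes> inv g) \<subseteq> conj_class x"
proof
  fix z assume "z \<in> conj_class (g \<otimes> x \<otimes> inv g)"
  then obtain h where h: "h \<in> carrier G" "z = h \<otimes> (g \<otimes> x \<otimes> inv g) \<otimes> inv h"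
    by (auto simp: conj_class_def)
  then have "z = (h \<otimes> g) \<otimes> x \<otimes> inv (h \<otimes> g)"
    using assms by (simp add: group_word_simps)
  then show "z \<in> conj_class x"
    using h assms by (auto simp: conj_class_def)
qed

lemma finite_representatives:
  assumes "finite (\<psi> ` B)"
  shows "\<exists>F\<subseteq>B. finite F \<and> (\<forall>x\<in>B. \<exists>f\<in>F. \<psi> f = \<psi> x)"
proof -
  obtain F where "F \<subseteq> B" "finite F" "\<psi> ` B = \<psi> ` F"
    using finite_subset_image[OF assms order_refl] by auto
  then show ?thesis by (metis imageE imageI)
qed

text \<open>The centralizer of a finite set of elements with finite classes has finite index, and
  \<open>F\<close> meets each of its left cosets. Sending g to the family of conjugates of
  \<open>T\<close> by g has finite range, and its fibres are exactly these cosets.\<close>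

lemma finite_index_centralizer:
  assumes "finite T" "T \<subseteq> carrier G" "\<And>t. t \<in> T \<Longrightarrow> finite (conj_class t)"
  obtains F where "finite F" "F \<subseteq> carrier G"
    "\<And>x. x \<in> carrier G \<Longrightarrow> \<exists>f\<in>F. \<forall>t\<in>T. (inv f \<otimes> x) \<otimes> t = t \<otimes> (inv f \<otimes> x)"
proof -
  \<comment> \<open>Restriction to \<open>T\<close> makes the value extensional, hence a member of
    the finite set \<open>PiE T conj_class\<close>.\<close>
  define \<psi> where "\<psi> g = restrict (\<lambda>t. g \<otimes> t \<otimes> inv g) T" for g
  have "\<psi> ` carrier G \<subseteq> PiE T conj_class"
    by (auto simp: \<psi>_def conj_class_def)
  then have "finite (\<psi> ` carrier G)"
    using assms by (meson finite_PiE finite_subset)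
  then obtain F where F: "finite F" "F \<subseteq> carrier G"
    "\<And>x. x \<in> carrier G \<Longrightarrow> \<exists>f\<in>F. \<psi> f = \<psi> x"
    using finite_representatives[of \<psi> "carrier G"] by auto
  show ?thesis
  proof (rule that[OF F(1,2)])
    fix x assume x: "x \<in> carrier G"
    then obtain f where f: "f \<in> F" "\<psi> f = \<psi> x" using F(3) by blast
    have "(inv f \<otimes> x) \<otimes> t = t \<otimes> (inv f \<otimes> x)" if t: "t \<in> T" for t
    proof -
      have "x \<otimes> t \<otimes> inv x = f \<otimes> t \<otimes> inv f"
        using fun_cong[OF f(2), of t] t by (simp add: \<psi>_def)
      then show ?thesis
        using conj_eq_iff[of x f t] x t f F(2) assms(2) by blast
    qed
    then show "\<exists>f\<in>F. \<forall>t\<in>T. (inv f \<otimes> x) \<otimes> t = t \<otimes> (inv f \<otimes> x)" using f by blast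
  qed
qed

text \<open>First half of B. H. Neumann's theorem. For an element a with a class of maximal size, a
  subgroup of finite index, the centralizer of conjugators producing that class, has all its
  commutators with G in a finite set; coset representatives carry this over to all
  commutators.\<close>

lemma finite_commutators_of_bounded_classes:
  assumes fin: "\<And>x. x \<in> carrier G \<Longrightarrow> finite (conj_class x)"
    and bound: "\<And>x. x \<in> carrier G \<Longrightarrow> card (conj_class x) \<le> k"
  shows "finite (derived_set G (carrier G))"
proof -
  obtain a where a: "a \<in> carrier G"
    and amax: "\<And>x. x \<in> carrier G \<Longrightarrow> card (conj_class x) \<le> card (conj_class a)"
    using ex_has_greatest_nat[of "\<lambda>x. x \<in> carrier G" \<one> "\<lambda>x. card (conj_class x)" "Suc k"] bound
    by (metis le_imp_less_Suc one_closed)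
  \<comment> \<open>\<open>T\<close> is a finite set of conjugators that already produces the whole
    class of \<open>a\<close>.\<close>
  obtain T where T: "T \<subseteq> carrier G" "finite T" "conj_class a = (\<lambda>g. g \<otimes> a \<otimes> inv g) ` T"
    using finite_subset_image[OF fin[OF a], of "\<lambda>g. g \<otimes> a \<otimes> inv g" "carrier G"]
    unfolding conj_class_def by auto
  obtain F where F: "finite F" "F \<subseteq> carrier G"
    "\<And>x. x \<in> carrier G \<Longrightarrow> \<exists>f\<in>F. \<forall>t\<in>T. (inv f \<otimes> x) \<otimes> t = t \<otimes> (inv f \<otimes> x)"
    using finite_index_centralizer[OF T(2,1)] fin T(1) by blast
  define D where "D = (\<lambda>(b, c). b \<otimes> inv c) ` (conj_class a \<times> conj_class a)"
  have D: "finite D" "D \<subseteq> carrier G"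
    using fin[OF a] conj_class_closed[OF a] by (auto simp: D_def)
  \<comment> \<open>If c centralizes T, then conjugating (inv c) a by T already produces as many
     elements as the class of a has, hence all conjugates of (inv c) a.\<close>
  have comm_D: "c \<otimes> g \<otimes> inv c \<otimes> inv g \<in> D"
    if c: "c \<in> carrier G" "\<forall>t\<in>T. c \<otimes> t = t \<otimes> c" and g: "g \<in> carrier G" for c g
  proof -
    let ?x = "inv c \<otimes> a"
    have sub: "(\<lambda>b. inv c \<otimes> b) ` conj_class a \<subseteq> conj_class ?x"
    proof
      fix z assume "z \<in> (\<lambda>b. inv c \<otimes> b) ` conj_class a"
      then obtain t where t: "t \<in> T" "z = inv c \<otimes> (t \<otimes> a \<otimes> inv t)"
        using T(3) by auto
      have tc: "t \<in> carrier G" using t T by auto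
      have "inv c \<otimes> t = t \<otimes> inv c"
      proof -
        have "inv c \<otimes> (c \<otimes> t) \<otimes> inv c = inv c \<otimes> (t \<otimes> c) \<otimes> inv c"
          using c t by simp
        then show ?thesis using c tc by (simp add: group_word_simps)
      qed
      then have "z = t \<otimes> ?x \<otimes> inv t"
        using t tc c a by (metis inv_closed m_assoc m_closed)
      then show "z \<in> conj_class ?x"
        using tc by (auto simp: conj_class_def)
    qed
    have "inj_on (\<lambda>b. inv c \<otimes> b) (conj_class a)"
      using conj_class_closed[OF a] c by (auto simp: inj_on_def subset_iff)
    then have "card ((\<lambda>b. inv c \<otimes> b) ` conj_class a) = card (conj_class a)"
      by (rule card_image)
    then have "(\<lambda>b. inv c \<otimes> b) ` conj_class a = conj_class ?x"
      using sub fin[of ?x] amax[of ?x] a c by (intro card_seteq) auto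
    moreover have "g \<otimes> ?x \<otimes> inv g \<in> conj_class ?x"
      using g by (auto simp: conj_class_def)
    ultimately obtain b where b: "b \<in> conj_class a" "g \<otimes> ?x \<otimes> inv g = inv c \<otimes> b"
      by auto
    have bc: "b \<in> carrier G" using b conj_class_closed[OF a] by auto
    have "b = c \<otimes> (g \<otimes> ?x \<otimes> inv g)"
      using b bc c by (simp add: inv_mult_cancel)
    then have "c \<otimes> g \<otimes> inv c \<otimes> inv g = b \<otimes> inv (g \<otimes> a \<otimes> inv g)"
      using a c g by (simp add: group_word_simps)
    moreover have "g \<otimes> a \<otimes> inv g \<in> conj_class a"
      using g by (auto simp: conj_class_def)
    ultimately show ?thesis using b by (auto simp: D_def)
  qed
  \<comment> \<open>Write h = f c with f in \<open>F\<close> and c centralizing \<open>T\<close>.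
    Then [h, g] = f [c, g] (g f^-1 g^-1), whose middle factor lies in \<open>D\<close> and whose
    last factor is a conjugate of f^-1.\<close>
  define E where "E = (\<lambda>(f, d, e). f \<otimes> d \<otimes> e) ` (SIGMA f:F. D \<times> conj_class (inv f))"
  have "finite E"
    unfolding E_def using F D fin by (intro finite_imageI finite_SigmaI) auto
  moreover have "derived_set G (carrier G) \<subseteq> E"
  proof clarsimp
    fix h g assume h: "h \<in> carrier G" and g: "g \<in> carrier G"
    obtain f where f: "f \<in> F" "\<forall>t\<in>T. (inv f \<otimes> h) \<otimes> t = t \<otimes> (inv f \<otimes> h)"
      using F(3)[OF h] by blast
    have fc: "f \<in> carrier G" using f F by auto
    let ?c = "inv f \<otimes> h"
    have "?c \<otimes> g \<otimes> inv ?c \<otimes> inv g \<in> D"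
      using comm_D[of ?c g] f fc h g by auto
    moreover have "g \<otimes> inv f \<otimes> inv g \<in> conj_class (inv f)"
      using g by (auto simp: conj_class_def)
    moreover have "h \<otimes> g \<otimes> inv h \<otimes> inv g
        = f \<otimes> (?c \<otimes> g \<otimes> inv ?c \<otimes> inv g) \<otimes> (g \<otimes> inv f \<otimes> inv g)"
      using fc h g by (simp add: group_word_simps)
    ultimately show "h \<otimes> g \<otimes> inv h \<otimes> inv g \<in> E"
      unfolding E_def using f(1) by (intro image_eqI[of _ _ "(f, ?c \<otimes> g \<otimes> inv ?c \<otimes> inv g, g \<otimes> inv f \<otimes> inv g)"]) auto
  qed
  ultimately show ?thesis by (rule rev_finite_subset)
qed

section \<open>Finitely many commutators\<close>

abbreviation list_prod :: "'a list \<Rightarrow> 'a" where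
  "list_prod w \<equiv> foldr (\<otimes>) w \<one>"

lemma list_prod_closed: "set w \<subseteq> carrier G \<Longrightarrow> list_prod w \<in> carrier G"
  by (induction w) auto

lemma list_prod_append:
  "set u \<subseteq> carrier G \<Longrightarrow> set v \<subseteq> carrier G \<Longrightarrow> list_prod (u @ v) = list_prod u \<otimes> list_prod v"
  by (induction u) (auto simp: m_assoc list_prod_closed)

text \<open>Occurrences of c can be moved to the front of a word at the price of conjugating the
  letters they pass. Since \<open>S\<close> is closed under conjugation, the new letters stay in
  \<open>S\<close> and the length is unchanged.\<close>

lemma list_prod_collect:
  assumes S: "S \<subseteq> carrier G"
    and conj: "\<And>g s. g \<in> carrier G \<Longrightarrow> s \<in> S \<Longrightarrow> g \<otimes> s \<otimes> inv g \<in> S"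
    and "set w \<subseteq> S" "c \<in> S" "k \<le> count_list w c"
  shows "\<exists>v. set v \<subseteq> S \<and> length v + k = length w \<and> list_prod w = c [^] k \<otimes> list_prod v"
  using assms(3,5)
proof (induction w arbitrary: k)
  case Nil
  then show ?case by auto
next
  case (Cons x w)
  have c: "c \<in> carrier G" and x: "x \<in> S" "x \<in> carrier G" using assms Cons.prems by auto
  show ?case
  proof (cases "x = c \<and> k \<noteq> 0")
    case True
    then obtain k' where k': "k = Suc k'" by (cases k) auto
    obtain v where v: "set v \<subseteq> S" "length v + k' = length w" "list_prod w = c [^] k' \<otimes> list_prod v"
      using Cons.IH[of k'] Cons.prems True k' by auto
    have "list_prod v \<in> carrier G" using v S by (meson list_prod_closed order_trans)
    then have "list_prod (x # w) = c [^] k \<otimes> list_prod v"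
      using True c v k' nat_pow_Suc2[OF c, of k'] by (simp add: m_assoc)
    then show ?thesis using v k' by auto
  next
    case False
    then have "k \<le> count_list w c" using Cons.prems by auto
    then obtain v where v: "set v \<subseteq> S" "length v + k = length w" "list_prod w = c [^] k \<otimes> list_prod v"
      using Cons.IH[of k] Cons.prems by auto
    \<comment> \<open>The first letter is passed by x c^k = c^k (c^-k x c^k).\<close>
    let ?g = "inv (c [^] k)"
    have "list_prod v \<in> carrier G" using v S by (meson list_prod_closed order_trans)
    then have "list_prod (x # w) = c [^] k \<otimes> list_prod ((?g \<otimes> x \<otimes> inv ?g) # v)"
      using c v x by (simp add: group_word_simps)
    moreover have "?g \<otimes> x \<otimes> inv ?g \<in> S" using conj[of ?g x] c x by auto
    ultimately show ?thesis using v
      by (intro exI[of _ "(?g \<otimes> x \<otimes> inv ?g) # v"]) auto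
  qed
qed

text \<open>Pigeonhole: two powers of c conjugate y to the same element, so their quotient
  centralizes y. \<open>Suc m\<close> records that the exponent is positive.\<close>

lemma power_commutes_of_finite_class:
  assumes "c \<in> carrier G" "y \<in> carrier G" "finite (conj_class y)"
  shows "\<exists>m. c [^] (Suc m) \<otimes> y = y \<otimes> c [^] (Suc m)"
proof -
  let ?f = "\<lambda>i::nat. c [^] i \<otimes> y \<otimes> inv (c [^] i)"
  have "range ?f \<subseteq> conj_class y" using assms by (auto simp: conj_class_def)
  then have "\<not> inj ?f" using assms(3) by (meson finite_imageD finite_subset infinite_UNIV_nat)
  then obtain i j where ij: "i < j" "?f j = ?f i"
    unfolding inj_def by (metis linorder_neq_iff)
  then have "inv (c [^] i) \<otimes> c [^] j \<otimes> y = y \<otimes> (inv (c [^] i) \<otimes> c [^] j)"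
    using conj_eq_iff[of "c [^] j" "c [^] i" y] assms by simp
  moreover have "inv (c [^] i) \<otimes> c [^] j = c [^] (j - i)"
    using assms ij by (intro inv_solve_left'[THEN iffD2]) (simp_all add: nat_pow_mult)
  moreover have "j - i = Suc (j - i - 1)" using ij by simp
  ultimately show ?thesis by metis
qed

lemma commutator_conj:
  assumes "g \<in> carrier G" "s \<in> derived_set G (carrier G)"
  shows "g \<otimes> s \<otimes> inv g \<in> derived_set G (carrier G)"
proof -
  obtain x y where xy: "x \<in> carrier G" "y \<in> carrier G" "s = x \<otimes> y \<otimes> inv x \<otimes> inv y"
    using assms(2) by auto
  let ?x = "g \<otimes> x \<otimes> inv g" and ?y = "g \<otimes> y \<otimes> inv g"
  have "g \<otimes> s \<otimes> inv g = ?x \<otimes> ?y \<otimes> inv ?x \<otimes> inv ?y"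
    using assms(1) xy by (simp add: group_word_simps)
  moreover have "?x \<in> carrier G" "?y \<in> carrier G" using assms(1) xy by auto
  ultimately show ?thesis by blast
qed

text \<open>The exponent exceeds the number of commutators on the right by one. This saving of a
  letter is what bounds word lengths in the derived subgroup.\<close>

lemma commutator_power:
  assumes c: "c \<in> derived_set G (carrier G)"
    and fin: "\<And>y. y \<in> carrier G \<Longrightarrow> finite (conj_class y)"
  shows "\<exists>v. set v \<subseteq> derived_set G (carrier G) \<and> c [^] Suc (length v) = list_prod v"
proof -
  obtain x y where xy: "x \<in> carrier G" "y \<in> carrier G" "c = x \<otimes> y \<otimes> inv x \<otimes> inv y"
    using c by auto
  have cc: "c \<in> carrier G" using xy by auto
  obtain m where m: "c [^] (Suc m) \<otimes> y = y \<otimes> c [^] (Suc m)"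
    using power_commutes_of_finite_class[OF cc xy(2) fin[OF xy(2)]] by blast
  let ?d = "y \<otimes> c \<otimes> inv y"
  let ?e = "x \<otimes> (y \<otimes> y) \<otimes> inv x \<otimes> inv (y \<otimes> y)"
  have d: "?d \<in> carrier G" using xy cc by auto
  have rep: "list_prod (replicate n ?d) = y \<otimes> c [^] n \<otimes> inv y" for n
  proof (induction n)
    case (Suc n)
    then show ?case using xy(2) cc nat_pow_Suc2[OF cc, of n]
      by (simp add: group_word_simps)
  qed (use xy in simp)
  \<comment> \<open>[x, y] (y [x, y] inv y) = [x, y y] trades two commutators for one.\<close>
  have ced: "c \<otimes> ?d = ?e" using xy by (simp add: group_word_simps)
  have "c [^] Suc (Suc m) = c \<otimes> c [^] Suc m"
    by (rule nat_pow_Suc2[OF cc])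
  \<comment> \<open>The power c^(m+1) is fixed by conjugation with y, hence is the (m+1)-st power of
    \<open>?d\<close>. One factor \<open>?d\<close> then merges with the remaining \<open>c\<close>
    into \<open>?e\<close>.\<close>
  also have "c [^] Suc m = y \<otimes> c [^] Suc m \<otimes> inv y"
    using m cc xy by (metis inv_solve_right m_closed nat_pow_closed)
  also have "\<dots> = list_prod (replicate (Suc m) ?d)" by (simp only: rep)
  also have "\<dots> = ?d \<otimes> list_prod (replicate m ?d)" by simp
  also have "c \<otimes> \<dots> = ?e \<otimes> list_prod (replicate m ?d)"
    unfolding ced[symmetric] using cc d list_prod_closed[of "replicate m ?d"]
    by (intro m_assoc[symmetric]) (auto simp: set_replicate_conv_if)
  finally have "c [^] Suc (Suc m) = list_prod (?e # replicate m ?d)" by simp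
  moreover have "?e \<in> derived_set G (carrier G)" using xy by blast
  moreover have "?d \<in> derived_set G (carrier G)" using commutator_conj[OF xy(2) c] .
  ultimately show ?thesis
    by (intro exI[of _ "?e # replicate m ?d"]) (simp add: set_replicate_conv_if)
qed

lemma finite_class_of_finite_commutators:
  assumes "finite (derived_set G (carrier G))" "y \<in> carrier G"
  shows "finite (conj_class y)"
proof -
  have "conj_class y \<subseteq> (\<lambda>d. d \<otimes> y) ` derived_set G (carrier G)"
  proof
    fix z assume "z \<in> conj_class y"
    then obtain g where g: "g \<in> carrier G" "z = g \<otimes> y \<otimes> inv g" by (auto simp: conj_class_def)
    then have "z = (g \<otimes> y \<otimes> inv g \<otimes> inv y) \<otimes> y" using assms(2) by (simp add: group_word_simps)
    then show "z \<in> (\<lambda>d. d \<otimes> y) ` derived_set G (carrier G)" using g assms(2) by blast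
  qed
  then show ?thesis using assms(1) by (meson finite_imageI finite_subset)
qed

lemma generate_list_prod:
  assumes S: "S \<subseteq> carrier G" and inv: "\<And>s. s \<in> S \<Longrightarrow> inv s \<in> S"
    and "h \<in> generate G S"
  shows "\<exists>w. set w \<subseteq> S \<and> h = list_prod w"
  using assms(3)
proof (induction rule: generate.induct)
  case one
  show ?case by (intro exI[of _ "[]"]) simp
next
  case (incl h)
  then show ?case using S by (intro exI[of _ "[h]"]) auto
next
  case (inv h)
  then show ?case using S assms(2) by (intro exI[of _ "[inv h]"]) auto
next
  case (eng h1 h2)
  then obtain u v where "set u \<subseteq> S" "h1 = list_prod u" "set v \<subseteq> S" "h2 = list_prod v" by auto
  then show ?case using S by (intro exI[of _ "u @ v"]) (auto simp: list_prod_append subset_iff simp del: foldr_append)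
qed

text \<open>Every element of the derived subgroup is a word in commutators, and each word can be
  shortened below a fixed length. Over a finite alphabet only finitely many such words
  exist.\<close>

lemma finite_derived_of_finite_commutators:
  assumes fin: "finite (derived_set G (carrier G))"
  shows "finite (derived G (carrier G))"
proof -
  define S where "S = derived_set G (carrier G)"
  have S: "S \<subseteq> carrier G" unfolding S_def by auto
  have finS: "finite S" using fin by (simp only: S_def)
  have inv: "inv s \<in> S" if "s \<in> S" for s
  proof -
    obtain x y where xy: "x \<in> carrier G" "y \<in> carrier G" "s = x \<otimes> y \<otimes> inv x \<otimes> inv y"
      using \<open>s \<in> S\<close> unfolding S_def by auto
    then have "inv s = y \<otimes> x \<otimes> inv y \<otimes> inv x" by (simp add: group_word_simps)
    then show ?thesis using xy unfolding S_def by blast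
  qed
  have "\<forall>c\<in>S. \<exists>v. set v \<subseteq> S \<and> c [^] Suc (length v) = list_prod v"
    unfolding S_def
    by (intro ballI commutator_power finite_class_of_finite_commutators[OF fin])
  from bchoice[OF this] obtain V
    where "\<forall>c\<in>S. set (V c) \<subseteq> S \<and> c [^] Suc (length (V c)) = list_prod (V c)" ..
  note V = bspec[OF this]
  \<comment> \<open>The sum serves only as a uniform bound for the lengths
    \<open>length (V c)\<close>.\<close>
  define M where "M = (\<Sum>c\<in>S. length (V c))"
  have M: "length (V c) \<le> M" if "c \<in> S" for c
    unfolding M_def using finS that by (intro member_le_sum) auto
  let ?L = "card S * M"
  \<comment> \<open>A word longer than L repeats some commutator often enough for commutator_power to shorten it.\<close>
  have shorten: "\<exists>v. set v \<subseteq> S \<and> length v \<le> ?L \<and> list_prod w = list_prod v" if "set w \<subseteq> S" for w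
    using that
  proof (induction "length w" arbitrary: w rule: less_induct)
    case less
    show ?case
    proof (cases "length w \<le> ?L")
      case True
      then show ?thesis using less.prems by auto
    next
      case False
      have "length w = (\<Sum>c\<in>S. count_list w c)"
        using sum_count_set[OF less.prems finS] by simp
      then have "\<not> (\<forall>c\<in>S. count_list w c \<le> M)"
        using False sum_bounded_above[of S "count_list w" M] by auto
      then obtain c where c: "c \<in> S" "M < count_list w c" by (meson not_le)
      \<comment> \<open>More than \<open>M\<close> occurrences suffice to collect the exponent
        \<open>Suc (length (V c))\<close>; replacing that power by \<open>V c\<close> then removes
        one letter.\<close>
      have "Suc (length (V c)) \<le> count_list w c" using M[OF c(1)] c(2) by linarith
      then obtain v where v: "set v \<subseteq> S" "length v + Suc (length (V c)) = length w"
        "list_prod w = c [^] Suc (length (V c)) \<otimes> list_prod v"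
        using list_prod_collect[OF S commutator_conj[folded S_def] less.prems c(1)] by blast
      have "list_prod w = list_prod (V c @ v)"
        using v V[OF c(1)] S list_prod_append[of "V c" v] by (metis order_trans)
      moreover have "set (V c @ v) \<subseteq> S" using v V[OF c(1)] by simp
      moreover have "length (V c @ v) < length w" using v by simp
      ultimately show ?thesis using less.hyps by metis
    qed
  qed
  have "derived G (carrier G) \<subseteq> list_prod ` {w. set w \<subseteq> S \<and> length w \<le> ?L}"
  proof
    fix h assume "h \<in> derived G (carrier G)"
    then obtain w where "set w \<subseteq> S" "h = list_prod w"
      using generate_list_prod[OF S inv] unfolding derived_def S_def by blast
    then show "h \<in> list_prod ` {w. set w \<subseteq> S \<and> length w \<le> ?L}"
      using shorten by blast
  qed
  then show ?thesis
    using finite_lists_length_le[OF finS] by (meson finite_imageI finite_subset)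
qed

text \<open>Up to left multiplication by \<open>F\<close> in each coordinate, every pair commutes.
  Multiplying by some r^-1 first moves an element into the centralizer of a finite set
  \<open>E\<close>; a further factor from \<open>E\<close> then cancels the remaining
  commutator.\<close>

lemma finite_translates_commute:
  assumes fin: "finite (derived_set G (carrier G))"
  obtains F where "finite F" "F \<subseteq> carrier G"
    "\<And>x y. x \<in> carrier G \<Longrightarrow> y \<in> carrier G \<Longrightarrow>
       \<exists>f\<in>F. \<exists>f'\<in>F. (f \<otimes> x) \<otimes> (f' \<otimes> y) = (f' \<otimes> y) \<otimes> (f \<otimes> x)"
proof -
  define S where "S = derived_set G (carrier G)"
  have finS: "finite S" using fin by (simp only: S_def)
  \<comment> \<open>The commutator is written as s = e^-1 e'^-1 e e', by inverting both entries of
    the usual form, so that e' e s = e e'.\<close>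
  have "\<exists>z\<in>carrier G \<times> carrier G. s = inv (fst z) \<otimes> inv (snd z) \<otimes> fst z \<otimes> snd z" if "s \<in> S" for s
  proof -
    obtain x y where "x \<in> carrier G" "y \<in> carrier G" "s = x \<otimes> y \<otimes> inv x \<otimes> inv y"
      using \<open>s \<in> S\<close> unfolding S_def by auto
    then show ?thesis by (intro bexI[of _ "(inv x, inv y)"]) auto
  qed
  then obtain z where z: "\<And>s. s \<in> S \<Longrightarrow> z s \<in> carrier G \<times> carrier G"
      "\<And>s. s \<in> S \<Longrightarrow> s = inv (fst (z s)) \<otimes> inv (snd (z s)) \<otimes> fst (z s) \<otimes> snd (z s)"
    by metis
  define E where "E = (fst \<circ> z) ` S \<union> (snd \<circ> z) ` S"
  have E: "finite E" "E \<subseteq> carrier G" using finS z(1) by (fastforce simp: E_def)+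
  obtain R where R: "finite R" "R \<subseteq> carrier G"
    "\<And>x. x \<in> carrier G \<Longrightarrow> \<exists>r\<in>R. \<forall>e\<in>E. (inv r \<otimes> x) \<otimes> e = e \<otimes> (inv r \<otimes> x)"
    using finite_index_centralizer[OF E] finite_class_of_finite_commutators[OF fin] E(2) by blast
  define F where "F = (\<lambda>(e, r). e \<otimes> inv r) ` (E \<times> R)"
  show ?thesis
  proof (rule that[of F])
    show "finite F" "F \<subseteq> carrier G" using E R by (auto simp: F_def)
    fix x y assume x: "x \<in> carrier G" and y: "y \<in> carrier G"
    obtain r where r: "r \<in> R" "\<forall>e\<in>E. (inv r \<otimes> x) \<otimes> e = e \<otimes> (inv r \<otimes> x)" using R(3)[OF x] by blast
    obtain t where t: "t \<in> R" "\<forall>e\<in>E. (inv t \<otimes> y) \<otimes> e = e \<otimes> (inv t \<otimes> y)" using R(3)[OF y] by blast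
    define c where "c = inv r \<otimes> x"
    define d where "d = inv t \<otimes> y"
    have rt: "r \<in> carrier G" "t \<in> carrier G" using r t R by auto
    have cd: "c \<in> carrier G" "d \<in> carrier G" using rt x y by (auto simp: c_def d_def)
    let ?s = "d \<otimes> c \<otimes> inv d \<otimes> inv c"
    have s: "?s \<in> S" unfolding S_def using cd by blast
    define e where "e = fst (z ?s)"
    define e' where "e' = snd (z ?s)"
    have e: "e \<in> E" "e' \<in> E" "e \<in> carrier G" "e' \<in> carrier G" "?s = inv e \<otimes> inv e' \<otimes> e \<otimes> e'"
      using s z(1)[OF s] z(2)[OF s] by (auto simp: E_def e_def e'_def mem_Times_iff)
    have "c \<otimes> e' = e' \<otimes> c" "d \<otimes> e = e \<otimes> d"
      using r t e by (auto simp: c_def d_def)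
    then have 1: "(e \<otimes> c) \<otimes> (e' \<otimes> d) = (e \<otimes> e') \<otimes> (c \<otimes> d)" "(e' \<otimes> d) \<otimes> (e \<otimes> c) = (e' \<otimes> e) \<otimes> (d \<otimes> c)"
      using e cd by (metis m_assoc m_closed)+
    \<comment> \<open>Here d c = s c d by the choice of \<open>?s\<close>, and e' e s = e e' by the
      choice of \<open>e\<close> and \<open>e'\<close>.\<close>
    have "(e' \<otimes> e) \<otimes> (d \<otimes> c) = (e' \<otimes> e) \<otimes> ?s \<otimes> (c \<otimes> d)"
      using e(3,4) cd by (simp add: group_word_simps)
    also have "\<dots> = (e \<otimes> e') \<otimes> (c \<otimes> d)"
      unfolding e(5) using e(3,4) cd by (simp add: group_word_simps)
    finally have "(e \<otimes> c) \<otimes> (e' \<otimes> d) = (e' \<otimes> d) \<otimes> (e \<otimes> c)" using 1 by simp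
    moreover have "e \<otimes> c = (e \<otimes> inv r) \<otimes> x" "e' \<otimes> d = (e' \<otimes> inv t) \<otimes> y"
      using e rt x y by (simp_all add: c_def d_def m_assoc)
    moreover have "e \<otimes> inv r \<in> F" "e' \<otimes> inv t \<in> F"
      using e r t by (auto simp: F_def)
    ultimately show "\<exists>f\<in>F. \<exists>f'\<in>F. (f \<otimes> x) \<otimes> (f' \<otimes> y) = (f' \<otimes> y) \<otimes> (f \<otimes> x)"
      by metis
  qed
qed

section \<open>Finite-by-abelian-by-finite groups\<close>

text \<open>The hypothesis gives the FC-centre finite index and a uniform bound on its class sizes.
  By Neumann's theorem its derived subgroup is finite, and this is the required finite normal
  subgroup with abelian quotient.\<close>

lemma finite_by_abelian_by_finite_of_bounded_classes:
  assumes F: "finite F" "F \<subseteq> carrier G"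
    and cover: "\<And>g. g \<in> carrier G \<Longrightarrow>
      \<exists>f\<in>F. finite (conj_class (g \<otimes> inv f)) \<and> card (conj_class (g \<otimes> inv f)) \<le> k"
  shows "finite_by_abelian_by_finite G"
proof -
  \<comment> \<open>H is the FC-centre of G.\<close>
  define H where "H = {x \<in> carrier G. finite (conj_class x)}"
  have "conj_class \<one> \<subseteq> {\<one>}" by (auto simp: conj_class_def)
  then have one: "\<one> \<in> H" unfolding H_def using finite_subset by blast
  have sub: "subgroup H G"
  proof (rule subgroupI)
    show "H \<subseteq> carrier G" "H \<noteq> {}" using one by (auto simp: H_def)
    show "inv a \<in> H" if "a \<in> H" for a using that by (auto simp: H_def conj_class_inv)
    show "a \<otimes> b \<in> H" if "a \<in> H" "b \<in> H" for a b
      using that by (auto simp: H_def intro: conj_class_mult_bound(1))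
  qed
  have normal: "H \<lhd> G"
  proof (rule normal_invI[OF sub])
    fix x h assume x: "x \<in> carrier G" and "h \<in> H"
    then have h: "h \<in> carrier G" "finite (conj_class h)" by (simp_all add: H_def)
    have "finite (conj_class (x \<otimes> h \<otimes> inv x))"
      by (rule finite_subset[OF conj_class_conj[OF h(1) x] h(2)])
    then show "x \<otimes> h \<otimes> inv x \<in> H" using x h by (simp add: H_def)
  qed
  have "rcosets H \<subseteq> (\<lambda>f. H #> f) ` F"
  proof
    fix C assume "C \<in> rcosets H"
    then obtain g where g: "g \<in> carrier G" "C = H #> g" by (auto simp: RCOSETS_def)
    then obtain f where f: "f \<in> F" "finite (conj_class (g \<otimes> inv f))" using cover by blast
    then have "g \<otimes> inv f \<in> H" using g F by (auto simp: H_def)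
    moreover have "g = (g \<otimes> inv f) \<otimes> f" using g f F by (auto simp: m_assoc subset_iff)
    ultimately have "g \<in> H #> f" unfolding r_coset_def by blast
    then have "H #> f = H #> g" using repr_independence[of g H f] sub f F by blast
    then show "C \<in> (\<lambda>f. H #> f) ` F" using g f by blast
  qed
  then have fin_cosets: "finite (rcosets H)" using F by (meson finite_imageI finite_subset)
  \<comment> \<open>For g in \<open>H\<close> the factorization g = (g f^-1) f bounds the class size
    by k times that of f. Elements of \<open>F\<close> with an infinite class contribute
    \<open>card\<close> 0 to the sum, but the f that occurs lies in \<open>H\<close>.\<close>
  define m where "m = k * (\<Sum>f\<in>F. card (conj_class f))"
  have bound: "card (conj_class g) \<le> m" if g: "g \<in> H" for g
  proof -
    have gc: "g \<in> carrier G" using g by (simp add: H_def)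
    then obtain f where f: "f \<in> F" "finite (conj_class (g \<otimes> inv f))" "card (conj_class (g \<otimes> inv f)) \<le> k"
      using cover by blast
    have fc: "f \<in> carrier G" using f F by auto
    have "g \<otimes> inv f \<in> H" using f(2) fc gc by (simp add: H_def)
    then have "inv (g \<otimes> inv f) \<otimes> g \<in> H"
      by (intro subgroup.m_closed[OF sub _ g] subgroup.m_inv_closed[OF sub])
    then have "f \<in> H" using fc gc by (simp add: group_word_simps)
    then have "finite (conj_class f)" by (simp add: H_def)
    then have "card (conj_class ((g \<otimes> inv f) \<otimes> f)) \<le> card (conj_class (g \<otimes> inv f)) * card (conj_class f)"
      using f(2) fc gc by (intro conj_class_mult_bound(2)) auto
    also have "(g \<otimes> inv f) \<otimes> f = g" using fc gc by (simp add: m_assoc)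
    also have "card (conj_class (g \<otimes> inv f)) * card (conj_class f) \<le> m"
      unfolding m_def using f F by (intro mult_le_mono member_le_sum) auto
    finally show ?thesis .
  qed
  let ?H = "G\<lparr>carrier := H\<rparr>"
  interpret HG: group ?H by (rule subgroup_imp_group[OF sub])
  have class_sub: "HG.conj_class x \<subseteq> conj_class x" for x
    using subgroup.subset[OF sub] m_inv_consistent[OF sub] by (auto simp: HG.conj_class_def conj_class_def)
  have "finite (derived_set ?H (carrier ?H))"
  proof (rule HG.finite_commutators_of_bounded_classes[where k = m])
    fix x assume "x \<in> carrier ?H"
    then have x: "x \<in> H" by simp
    then have fin: "finite (conj_class x)" by (simp add: H_def)
    then show "finite (HG.conj_class x)" using class_sub by (rule rev_finite_subset)
    show "card (HG.conj_class x) \<le> m" using card_mono[OF fin class_sub] bound[OF x] by linarith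
  qed
  then have "finite (derived G H)"
    using HG.finite_derived_of_finite_commutators derived_consistent[OF order_refl sub] by simp
  then show ?thesis
    unfolding finite_by_abelian_by_finite_def
    by (intro exI[of _ H] conjI exI[of _ "derived G H"] normal fin_cosets
        derived_subgroup_is_normal[OF sub] derived_quot_of_subgroup_is_comm_group[OF sub])
qed

text \<open>As H/N is abelian, all commutators of H lie in the finite set N, so the translates found
  inside H can be combined with coset representatives of H in G.\<close>

lemma finite_translates_commute_of_finite_by_abelian_by_finite:
  assumes "finite_by_abelian_by_finite G"
  obtains F where "finite F" "F \<subseteq> carrier G"
    "\<And>x y. x \<in> carrier G \<Longrightarrow> y \<in> carrier G \<Longrightarrow>
       \<exists>f\<in>F. \<exists>f'\<in>F. (f \<otimes> x) \<otimes> (f' \<otimes> y) = (f' \<otimes> y) \<otimes> (f \<otimes> x)"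
proof -
  obtain H N where H: "H \<lhd> G" "finite (rcosets H)"
    and N: "N \<lhd> G\<lparr>carrier := H\<rparr>" "finite N" "comm_group (G\<lparr>carrier := H\<rparr> Mod N)"
    using assms unfolding finite_by_abelian_by_finite_def by blast
  let ?H = "G\<lparr>carrier := H\<rparr>"
  have sub: "subgroup H G" using H(1) by (rule normal_imp_subgroup)
  interpret H: subgroup H G by (rule sub)
  interpret HG: group ?H by (rule subgroup_imp_group[OF sub])
  have "derived_set G H \<subseteq> derived G H"
    unfolding derived_def by (rule subsetI, rule generate.incl)
  also have "\<dots> \<subseteq> N" by (rule derived_of_subgroup_minimal[OF N(1) sub N(3)])
  finally have "finite (derived_set G H)" using N(2) by (rule finite_subset)
  then have "finite (derived_set ?H (carrier ?H))"
    using derived_set_consistent[OF order_refl sub] by simp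
  then obtain E where "finite E" "E \<subseteq> carrier ?H"
    "\<And>x y. x \<in> carrier ?H \<Longrightarrow> y \<in> carrier ?H \<Longrightarrow>
       \<exists>e\<in>E. \<exists>e'\<in>E. (e \<otimes>\<^bsub>?H\<^esub> x) \<otimes>\<^bsub>?H\<^esub> (e' \<otimes>\<^bsub>?H\<^esub> y) = (e' \<otimes>\<^bsub>?H\<^esub> y) \<otimes>\<^bsub>?H\<^esub> (e \<otimes>\<^bsub>?H\<^esub> x)"
    by (rule HG.finite_translates_commute) blast
  then have E: "finite E" "E \<subseteq> H"
    "\<And>x y. x \<in> H \<Longrightarrow> y \<in> H \<Longrightarrow> \<exists>e\<in>E. \<exists>e'\<in>E. (e \<otimes> x) \<otimes> (e' \<otimes> y) = (e' \<otimes> y) \<otimes> (e \<otimes> x)"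
    by simp_all
  \<comment> \<open>Inversion turns the given right cosets into left cosets, as representatives with
    r^-1 x in \<open>H\<close> are wanted.\<close>
  have "(\<lambda>g. H #> inv g) ` carrier G \<subseteq> rcosets H" by (auto simp: RCOSETS_def)
  then have "finite ((\<lambda>g. H #> inv g) ` carrier G)" using H(2) by (rule finite_subset)
  then obtain R where R: "finite R" "R \<subseteq> carrier G"
    "\<And>x. x \<in> carrier G \<Longrightarrow> \<exists>r\<in>R. H #> inv r = H #> inv x"
    using finite_representatives[of "\<lambda>g. H #> inv g" "carrier G"] by auto
  have R': "\<exists>r\<in>R. inv r \<otimes> x \<in> H" if x: "x \<in> carrier G" for x
  proof -
    obtain r where r: "r \<in> R" "H #> inv r = H #> inv x" using R(3)[OF x] by blast
    have rc: "r \<in> carrier G" using r R by auto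
    have "inv r \<in> H #> inv x" using rcos_self[OF inv_closed[OF rc] sub] r(2) by simp
    then obtain h where h: "h \<in> H" "inv r = h \<otimes> inv x" by (auto simp: r_coset_def)
    then have "inv r \<otimes> x = h" using x by (simp add: m_assoc)
    then show ?thesis using h(1) r(1) by metis
  qed
  show ?thesis
  proof (rule that[of "(\<lambda>(e, r). e \<otimes> inv r) ` (E \<times> R)"])
    show "finite ((\<lambda>(e, r). e \<otimes> inv r) ` (E \<times> R))" using E R by auto
    show "(\<lambda>(e, r). e \<otimes> inv r) ` (E \<times> R) \<subseteq> carrier G"
      using E(2) R(2) H.subset by (auto simp: subset_iff)
    fix x y assume xy: "x \<in> carrier G" "y \<in> carrier G"
    obtain r t where rt: "r \<in> R" "inv r \<otimes> x \<in> H" "t \<in> R" "inv t \<otimes> y \<in> H"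
      using R' xy by blast
    obtain e e' where e: "e \<in> E" "e' \<in> E"
      "(e \<otimes> (inv r \<otimes> x)) \<otimes> (e' \<otimes> (inv t \<otimes> y)) = (e' \<otimes> (inv t \<otimes> y)) \<otimes> (e \<otimes> (inv r \<otimes> x))"
      using E(3)[OF rt(2,4)] by blast
    have "r \<in> carrier G" "t \<in> carrier G" "e \<in> carrier G" "e' \<in> carrier G"
      using rt R e E H.subset by auto
    then have "(e \<otimes> inv r) \<otimes> x = e \<otimes> (inv r \<otimes> x)" "(e' \<otimes> inv t) \<otimes> y = e' \<otimes> (inv t \<otimes> y)"
      using xy by (simp_all add: m_assoc)
    then have "((e \<otimes> inv r) \<otimes> x) \<otimes> ((e' \<otimes> inv t) \<otimes> y) = ((e' \<otimes> inv t) \<otimes> y) \<otimes> ((e \<otimes> inv r) \<otimes> x)"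
      using e(3) by simp
    moreover have "e \<otimes> inv r \<in> (\<lambda>(e, r). e \<otimes> inv r) ` (E \<times> R)" "e' \<otimes> inv t \<in> (\<lambda>(e, r). e \<otimes> inv r) ` (E \<times> R)"
      using e rt by auto
    ultimately show "\<exists>f\<in>(\<lambda>(e, r). e \<otimes> inv r) ` (E \<times> R). \<exists>f'\<in>(\<lambda>(e, r). e \<otimes> inv r) ` (E \<times> R).
        (f \<otimes> x) \<otimes> (f' \<otimes> y) = (f' \<otimes> y) \<otimes> (f \<otimes> x)"
      by blast
  qed
qed

end

section \<open>Invariant means\<close>

context
  fixes K :: "('a, 'm) monoid_scheme" and \<mu> :: "'a set \<Rightarrow> real"
  assumes mean: "left_invariant_mean K \<mu>"
begin

lemma mean_nonneg: "A \<subseteq> carrier K \<Longrightarrow> 0 \<le> \<mu> A"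
  and mean_le_1: "A \<subseteq> carrier K \<Longrightarrow> \<mu> A \<le> 1"
  and mean_carrier: "\<mu> (carrier K) = 1"
  and mean_disjoint_Un: "A \<subseteq> carrier K \<Longrightarrow> B \<subseteq> carrier K \<Longrightarrow> A \<inter> B = {} \<Longrightarrow> \<mu> (A \<union> B) = \<mu> A + \<mu> B"
  and mean_l_coset: "k \<in> carrier K \<Longrightarrow> A \<subseteq> carrier K \<Longrightarrow> \<mu> (k <#\<^bsub>K\<^esub> A) = \<mu> A"
  using mean unfolding left_invariant_mean_def by auto

lemma mean_empty: "\<mu> {} = 0"
  using mean_disjoint_Un[of "{}" "{}"] by simp

lemma mean_mono:
  assumes "A \<subseteq> B" "B \<subseteq> carrier K"
  shows "\<mu> A \<le> \<mu> B"
proof -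
  have "\<mu> (A \<union> (B - A)) = \<mu> A + \<mu> (B - A)"
    using assms by (intro mean_disjoint_Un) auto
  moreover have "A \<union> (B - A) = B" using assms by auto
  moreover have "0 \<le> \<mu> (B - A)" using assms by (intro mean_nonneg) auto
  ultimately show ?thesis by simp
qed

lemma mean_Un_Int:
  assumes "A \<subseteq> carrier K" "B \<subseteq> carrier K"
  shows "\<mu> (A \<union> B) + \<mu> (A \<inter> B) = \<mu> A + \<mu> B"
proof -
  have "\<mu> (A \<union> (B - A)) = \<mu> A + \<mu> (B - A)" "\<mu> ((A \<inter> B) \<union> (B - A)) = \<mu> (A \<inter> B) + \<mu> (B - A)"
    using assms by (intro mean_disjoint_Un; auto)+
  moreover have "A \<union> (B - A) = A \<union> B" "(A \<inter> B) \<union> (B - A) = B" by auto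
  ultimately show ?thesis by simp
qed

lemma mean_UN_le:
  assumes "finite I" "\<And>i. i \<in> I \<Longrightarrow> A i \<subseteq> carrier K"
  shows "\<mu> (\<Union>i\<in>I. A i) \<le> (\<Sum>i\<in>I. \<mu> (A i))"
  using assms
proof (induction I)
  case empty
  then show ?case by (simp add: mean_empty)
next
  case (insert j I)
  have "\<mu> (A j \<union> (\<Union>i\<in>I. A i)) + \<mu> (A j \<inter> (\<Union>i\<in>I. A i)) = \<mu> (A j) + \<mu> (\<Union>i\<in>I. A i)"
    using insert.prems by (intro mean_Un_Int) auto
  moreover have "0 \<le> \<mu> (A j \<inter> (\<Union>i\<in>I. A i))"
    using insert.prems by (intro mean_nonneg) auto
  ultimately show ?case using insert by simp
qed

text \<open>A coarse Bonferroni inequality: a new set meets the union of the earlier n ones in mean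
  at most n \<epsilon>, and n^2 + n \<le> (n + 1)^2 keeps the error quadratic.\<close>

lemma mean_bonferroni:
  assumes "finite I" "\<And>i. i \<in> I \<Longrightarrow> A i \<subseteq> carrier K" "0 \<le> \<epsilon>"
    and "\<And>i j. i \<in> I \<Longrightarrow> j \<in> I \<Longrightarrow> i \<noteq> j \<Longrightarrow> \<mu> (A i \<inter> A j) \<le> \<epsilon>"
  shows "(\<Sum>i\<in>I. \<mu> (A i)) \<le> \<mu> (\<Union>i\<in>I. A i) + (real (card I))\<^sup>2 * \<epsilon>"
  using assms
proof (induction I)
  case empty
  then show ?case by (simp add: mean_empty)
next
  case (insert j I)
  have "\<mu> (A j \<union> (\<Union>i\<in>I. A i)) + \<mu> (A j \<inter> (\<Union>i\<in>I. A i)) = \<mu> (A j) + \<mu> (\<Union>i\<in>I. A i)"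
    using insert.prems by (intro mean_Un_Int) auto
  moreover have "\<mu> (A j \<inter> (\<Union>i\<in>I. A i)) \<le> real (card I) * \<epsilon>"
  proof -
    have "\<mu> (\<Union>i\<in>I. A j \<inter> A i) \<le> (\<Sum>i\<in>I. \<mu> (A j \<inter> A i))"
      using insert by (intro mean_UN_le) auto
    also have "\<dots> \<le> (\<Sum>i\<in>I. \<epsilon>)"
      using insert by (intro sum_mono insert.prems(3)) auto
    finally show ?thesis by simp
  qed
  moreover have "(\<Sum>i\<in>I. \<mu> (A i)) \<le> \<mu> (\<Union>i\<in>I. A i) + (real (card I))\<^sup>2 * \<epsilon>"
    using insert by auto
  moreover have "(real (card I))\<^sup>2 * \<epsilon> + real (card I) * \<epsilon> \<le> (real (card (insert j I)))\<^sup>2 * \<epsilon>"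
    using insert.hyps \<open>0 \<le> \<epsilon>\<close> by (simp add: power2_eq_square algebra_simps)
  ultimately show ?case using insert.hyps by simp
qed

text \<open>Invariance in preimage form, since the preimage of A under multiplication by k is the
  translate of A by k^-1.\<close>

lemma mean_translate:
  assumes "group K" "k \<in> carrier K" "A \<subseteq> carrier K"
  shows "\<mu> {z \<in> carrier K. k \<otimes>\<^bsub>K\<^esub> z \<in> A} = \<mu> A"
proof -
  interpret group K by fact
  have "{z \<in> carrier K. k \<otimes>\<^bsub>K\<^esub> z \<in> A} = inv\<^bsub>K\<^esub> k <#\<^bsub>K\<^esub> A" (is "?L = ?R")
  proof
    show "?L \<subseteq> ?R"
    proof
      fix z assume "z \<in> ?L"
      then have "k \<otimes>\<^bsub>K\<^esub> z \<in> A" "z = inv\<^bsub>K\<^esub> k \<otimes>\<^bsub>K\<^esub> (k \<otimes>\<^bsub>K\<^esub> z)"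
        using assms by (auto simp: inv_mult_cancel)
      then show "z \<in> ?R" unfolding l_coset_def by blast
    qed
    show "?R \<subseteq> ?L"
      using assms by (auto simp: l_coset_def inv_mult_cancel subset_iff)
  qed
  then show ?thesis using mean_l_coset[of "inv\<^bsub>K\<^esub> k" A] assms by simp
qed

end

section \<open>From the mean of the commuting pairs to bounded conjugacy classes\<close>

lemma Comm_subset: "Comm G \<subseteq> carrier (G \<times>\<times> G)"
  by (auto simp: Comm_def)

context group
begin

text \<open>The set \<open>?B\<close> is G x C(g). Its translates \<open>A t\<close>, one for each
  conjugate t of g, are disjoint and of equal mean, so m of them would have total mean above
  1.\<close>

lemma conj_class_bound_of_mean:
  assumes mean: "left_invariant_mean (G \<times>\<times> G) \<mu>" and g: "g \<in> carrier G"
    and m: "1 < real m * \<mu> {(x, y). x \<in> carrier G \<and> y \<in> carrier G \<and> g \<otimes> y = y \<otimes> g}"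
      (is "1 < _ * \<mu> ?B")
  shows "finite (conj_class g)" and "card (conj_class g) < m"
proof -
  have P: "group (G \<times>\<times> G)" by (rule DirProd_group[OF is_group is_group])
  have small: "card T \<noteq> m" if T: "finite T" "T \<subseteq> conj_class g" for T
  proof
    assume card: "card T = m"
    define A where "A t = {(x, y). x \<in> carrier G \<and> y \<in> carrier G \<and> y \<otimes> g \<otimes> inv y = t}" for t
    have A: "\<mu> (A t) = \<mu> ?B" if t: "t \<in> T" for t
    proof -
      obtain h where h: "h \<in> carrier G" "t = h \<otimes> g \<otimes> inv h"
        using t T by (auto simp: conj_class_def)
      \<comment> \<open>By \<open>conj_eq_iff\<close>, y g y^-1 = h g h^-1 holds exactly when h^-1 y
        centralizes g.\<close>
      have "A t = {z \<in> carrier (G \<times>\<times> G). (\<one>, inv h) \<otimes>\<^bsub>G \<times>\<times> G\<^esub> z \<in> ?B}"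
        using h g by (auto simp: A_def conj_eq_iff)
      then show ?thesis
        using mean_translate[OF mean P, of "(\<one>, inv h)" ?B] h by auto
    qed
    have "(\<Sum>t\<in>T. \<mu> (A t)) \<le> \<mu> (\<Union>t\<in>T. A t) + (real (card T))\<^sup>2 * 0"
    proof (rule mean_bonferroni[OF mean T(1)])
      show "A t \<subseteq> carrier (G \<times>\<times> G)" for t by (auto simp: A_def)
      show "\<mu> (A s \<inter> A t) \<le> 0" if "s \<noteq> t" for s t
      proof -
        have "A s \<inter> A t = {}" using that by (auto simp: A_def)
        then show ?thesis using mean_empty[OF mean] by simp
      qed
    qed simp
    also have "\<mu> (\<Union>t\<in>T. A t) \<le> 1"
      by (rule mean_le_1[OF mean]) (auto simp: A_def)
    finally show False using A card m by simp
  qed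
  \<comment> \<open>An infinite class, or one of size at least m, would contain a subset of exactly
    m elements.\<close>
  show fin: "finite (conj_class g)"
    using small infinite_arbitrarily_large[of "conj_class g" m] by blast
  show "card (conj_class g) < m"
    using small obtain_subset_with_card_n[of m "conj_class g"] fin
    by (metis finite_subset not_le)
qed

text \<open>The translates of \<open>Comm G\<close> by elements of \<open>F\<close> have total mean
  at least 2 inside a space of mean 1, so two of them overlap substantially, and the overlap lies in
  G x C(f f'^-1).\<close>

lemma bounded_class_quotient_of_mean:
  assumes mean: "left_invariant_mean (G \<times>\<times> G) \<mu>" and F: "F \<subseteq> carrier G" "finite F"
    and card: "2 \<le> real (card F) * \<mu> (Comm G)"
  shows "\<exists>f\<in>F. \<exists>f'\<in>F. f \<noteq> f' \<and> finite (conj_class (f \<otimes> inv f'))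
           \<and> card (conj_class (f \<otimes> inv f')) \<le> 2 * (card F)\<^sup>2"
proof -
  have P: "group (G \<times>\<times> G)" by (rule DirProd_group[OF is_group is_group])
  let ?n = "real (card F)"
  have n: "?n > 0" using card by (cases "card F = 0") auto
  \<comment> \<open>Chosen so that the Bonferroni error is 1/2: if all overlaps were at most
    \<epsilon>, then 2 \<le> 1 + 1/2.\<close>
  define \<epsilon> where "\<epsilon> = 1 / (2 * ?n\<^sup>2)"
  have \<epsilon>: "0 \<le> \<epsilon>" "?n\<^sup>2 * \<epsilon> = 1 / 2" using n by (auto simp: \<epsilon>_def)
  define A where "A f = {z \<in> carrier (G \<times>\<times> G). (f, \<one>) \<otimes>\<^bsub>G \<times>\<times> G\<^esub> z \<in> Comm G}" for f
  have A: "\<mu> (A f) = \<mu> (Comm G)" if "f \<in> F" for f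
    unfolding A_def using F that by (intro mean_translate[OF mean P] Comm_subset) auto
  have "\<exists>f\<in>F. \<exists>f'\<in>F. f \<noteq> f' \<and> \<epsilon> < \<mu> (A f \<inter> A f')"
  proof (rule ccontr)
    assume "\<not> ?thesis"
    then have "(\<Sum>f\<in>F. \<mu> (A f)) \<le> \<mu> (\<Union>f\<in>F. A f) + ?n\<^sup>2 * \<epsilon>"
      using F \<epsilon>(1) by (intro mean_bonferroni[OF mean]) (auto simp: A_def not_less)
    also have "\<mu> (\<Union>f\<in>F. A f) \<le> 1"
      by (rule mean_le_1[OF mean]) (auto simp: A_def)
    finally show False using A card \<epsilon> by simp
  qed
  then obtain f f' where f: "f \<in> F" "f' \<in> F" "f \<noteq> f'" "\<epsilon> < \<mu> (A f \<inter> A f')" by blast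
  have fc: "f \<in> carrier G" "f' \<in> carrier G" using f F by auto
  let ?g = "f \<otimes> inv f'"
  let ?B = "{(x, y). x \<in> carrier G \<and> y \<in> carrier G \<and> ?g \<otimes> y = y \<otimes> ?g}"
  have "A f \<inter> A f' \<subseteq> ?B"
  proof clarify
    fix x y assume "(x, y) \<in> A f" "(x, y) \<in> A f'"
    then have xy: "x \<in> carrier G" "y \<in> carrier G"
      and 1: "(f \<otimes> x) \<otimes> y = y \<otimes> (f \<otimes> x)" and 2: "(f' \<otimes> x) \<otimes> y = y \<otimes> (f' \<otimes> x)"
      by (auto simp: A_def Comm_def)
    let ?u = "f' \<otimes> x"
    have u: "?u \<in> carrier G" using fc xy by simp
    \<comment> \<open>The factor x cancels in the quotient of f x and f' x; both commute with y,
      hence so does f f'^-1.\<close>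
    have g: "?g = (f \<otimes> x) \<otimes> inv ?u" using fc xy by (simp add: group_word_simps)
    have "inv ?u \<otimes> (?u \<otimes> y) \<otimes> inv ?u = inv ?u \<otimes> (y \<otimes> ?u) \<otimes> inv ?u" using 2 by simp
    then have "y \<otimes> inv ?u = inv ?u \<otimes> y" using u xy by (simp add: m_assoc inv_mult_cancel)
    then have "?g \<otimes> y = ((f \<otimes> x) \<otimes> y) \<otimes> inv ?u"
      unfolding g using u xy fc by (simp add: m_assoc)
    also have "\<dots> = y \<otimes> ?g" unfolding 1 g using u xy fc by (simp add: m_assoc)
    finally show "x \<in> carrier G \<and> y \<in> carrier G \<and> ?g \<otimes> y = y \<otimes> ?g" using xy by simp
  qed
  then have "\<mu> (A f \<inter> A f') \<le> \<mu> ?B"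
    by (rule mean_mono[OF mean]) auto
  then have B: "\<epsilon> < \<mu> ?B" using f(4) by simp
  \<comment> \<open>With the added 1, the strict bound of \<open>conj_class_bound_of_mean\<close>
    reads as the claimed \<le>.\<close>
  let ?m = "2 * (card F)\<^sup>2 + 1"
  have "1 = 2 * ?n\<^sup>2 * \<epsilon>" using \<epsilon>(2) by simp
  also have "\<dots> \<le> real ?m * \<epsilon>" using \<epsilon>(1) by (intro mult_right_mono) auto
  also have "\<dots> < real ?m * \<mu> ?B"
    using B by (rule mult_strict_left_mono) (simp add: add_pos_nonneg)
  finally have "1 < real ?m * \<mu> ?B" .
  from conj_class_bound_of_mean[OF mean _ this] f fc show ?thesis
    by (intro bexI[of _ f] bexI[of _ f']) auto
qed

text \<open>A set whose quotients of distinct elements all have large or infinite classes has fewer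
  than n elements. One of largest size cannot be enlarged, so every g has a small quotient with some
  member.\<close>

lemma bounded_class_cover_of_mean:
  assumes mean: "left_invariant_mean (G \<times>\<times> G) \<mu>" and pos: "0 < \<mu> (Comm G)"
  shows "\<exists>F k. finite F \<and> F \<subseteq> carrier G \<and>
    (\<forall>g\<in>carrier G. \<exists>f\<in>F. finite (conj_class (g \<otimes> inv f)) \<and> card (conj_class (g \<otimes> inv f)) \<le> k)"
proof -
  obtain n :: nat where "2 / \<mu> (Comm G) < real n" using reals_Archimedean2 by blast
  then have n: "2 \<le> real n * \<mu> (Comm G)" using pos by (simp add: field_simps)
  have n0: "n \<noteq> 0" using n by (intro notI) simp
  define k where "k = 2 * n\<^sup>2"
  define Q where "Q x \<longleftrightarrow> finite (conj_class x) \<and> card (conj_class x) \<le> k" for x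
  define sep where "sep F \<longleftrightarrow> finite F \<and> F \<subseteq> carrier G \<and> (\<forall>f\<in>F. \<forall>f'\<in>F. f \<noteq> f' \<longrightarrow> \<not> Q (f \<otimes> inv f'))" for F
  have small: "card F < n" if "sep F" for F
  proof (rule ccontr)
    \<comment> \<open>Passing to exactly n elements makes the class bound equal to the fixed
      \<open>k\<close>.\<close>
    assume "\<not> card F < n"
    then obtain F' where F': "F' \<subseteq> F" "card F' = n" "finite F'"
      using obtain_subset_with_card_n[of n F] by auto
    have "F' \<subseteq> carrier G" using F' \<open>sep F\<close> by (auto simp: sep_def)
    from bounded_class_quotient_of_mean[OF mean this F'(3)] n F'(2)
    obtain f f' where "f \<in> F'" "f' \<in> F'" "f \<noteq> f'" "Q (f \<otimes> inv f')"
      unfolding Q_def k_def by blast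
    then show False using F' \<open>sep F\<close> by (auto simp: sep_def)
  qed
  have "sep {}" by (simp add: sep_def)
  then obtain F where F: "sep F" and Fmax: "\<And>F'. sep F' \<Longrightarrow> card F' \<le> card F"
    using ex_has_greatest_nat[of sep "{}" card n] small by blast
  have "\<exists>f\<in>F. Q (g \<otimes> inv f)" if g: "g \<in> carrier G" for g
  proof (cases "g \<in> F")
    case True
    have "conj_class \<one> = {\<one>}" by (auto simp: conj_class_def)
    \<comment> \<open>This needs \<open>k\<close> to be at least 1, which follows from
      \<open>n0\<close>.\<close>
    then have "Q \<one>" using n0 by (simp add: Q_def k_def)
    then show ?thesis using True g by (intro bexI[of _ g]) simp_all
  next
    case False
    have "card F < card (insert g F)" using False F by (simp add: sep_def)
    then have "\<not> sep (insert g F)" using Fmax[of "insert g F"] by linarith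
    moreover have "finite (insert g F)" "insert g F \<subseteq> carrier G"
      using F g by (auto simp: sep_def)
    ultimately obtain a b where "a \<in> insert g F" "b \<in> insert g F" "a \<noteq> b" "Q (a \<otimes> inv b)"
      unfolding sep_def by blast
    then obtain f where f: "f \<in> F" "Q (g \<otimes> inv f) \<or> Q (f \<otimes> inv g)"
      using F unfolding sep_def by blast
    have fc: "f \<in> carrier G" using f F by (auto simp: sep_def)
    \<comment> \<open>Failure of separation may give the quotient in either order; inversion
      preserves class sizes.\<close>
    have "Q (inv x)" if "x \<in> carrier G" "Q x" for x
      using that by (simp add: Q_def card_conj_class_inv conj_class_inv[of x])
        (metis card_conj_class_inv conj_class_inv)
    from this[of "f \<otimes> inv g"] have "Q (f \<otimes> inv g) \<Longrightarrow> Q (g \<otimes> inv f)"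
      using fc g by (simp add: inv_mult_group)
    then show ?thesis using f by blast
  qed
  then show ?thesis using F unfolding sep_def Q_def by blast
qed

end

theorem theorem1p6:
  fixes G :: "('a, 'm) monoid_scheme"
    and \<mu> :: "('a \<times> 'a) set \<Rightarrow> real"
  assumes "group G"
    and "amenable G"
    and "left_invariant_mean (G \<times>\<times> G) \<mu>"
  shows "\<mu> (Comm G) > 0 \<longleftrightarrow> finite_by_abelian_by_finite G"
proof
  interpret group G by fact
  note mean = assms(3)
  {
    assume "\<mu> (Comm G) > 0"
    then obtain F k where "finite F" "F \<subseteq> carrier G"
      "\<And>g. g \<in> carrier G \<Longrightarrow>
        \<exists>f\<in>F. finite (conj_class (g \<otimes>\<^bsub>G\<^esub> inv\<^bsub>G\<^esub> f)) \<and> card (conj_class (g \<otimes>\<^bsub>G\<^esub> inv\<^bsub>G\<^esub> f)) \<le> k"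
      using bounded_class_cover_of_mean[OF mean] by blast
    then show "finite_by_abelian_by_finite G"
      by (rule finite_by_abelian_by_finite_of_bounded_classes)
  next
    assume "finite_by_abelian_by_finite G"
    then obtain F where F: "finite F" "F \<subseteq> carrier G"
      and comm: "\<And>x y. x \<in> carrier G \<Longrightarrow> y \<in> carrier G \<Longrightarrow>
        \<exists>f\<in>F. \<exists>f'\<in>F. (f \<otimes>\<^bsub>G\<^esub> x) \<otimes>\<^bsub>G\<^esub> (f' \<otimes>\<^bsub>G\<^esub> y) = (f' \<otimes>\<^bsub>G\<^esub> y) \<otimes>\<^bsub>G\<^esub> (f \<otimes>\<^bsub>G\<^esub> x)"
      by (rule finite_translates_commute_of_finite_by_abelian_by_finite) blast
    define A where "A p = {z \<in> carrier (G \<times>\<times> G). p \<otimes>\<^bsub>G \<times>\<times> G\<^esub> z \<in> Comm G}" for p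
    have P: "group (G \<times>\<times> G)" by (rule DirProd_group[OF is_group is_group])
    have A: "\<mu> (A p) = \<mu> (Comm G)" if "p \<in> F \<times> F" for p
      unfolding A_def using F that by (intro mean_translate[OF mean P] Comm_subset) auto
    \<comment> \<open>The preimages \<open>A p\<close> of \<open>Comm G\<close>, all of the same
      mean, cover G x G; subadditivity then gives 1 \<le> |F|^2 \<mu>(Comm G).\<close>
    have "carrier (G \<times>\<times> G) \<subseteq> (\<Union>p\<in>F \<times> F. A p)"
    proof clarsimp
      fix x y assume xy: "x \<in> carrier G" "y \<in> carrier G"
      then obtain f f' where "f \<in> F" "f' \<in> F"
        "(f \<otimes>\<^bsub>G\<^esub> x) \<otimes>\<^bsub>G\<^esub> (f' \<otimes>\<^bsub>G\<^esub> y) = (f' \<otimes>\<^bsub>G\<^esub> y) \<otimes>\<^bsub>G\<^esub> (f \<otimes>\<^bsub>G\<^esub> x)"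
        using comm by blast
      then show "\<exists>f\<in>F. \<exists>f'\<in>F. (x, y) \<in> A (f, f')"
        using xy F(2) by (intro bexI[of _ f] bexI[of _ f']) (auto simp: A_def Comm_def subset_iff)
    qed
    then have "\<mu> (carrier (G \<times>\<times> G)) \<le> \<mu> (\<Union>p\<in>F \<times> F. A p)"
      by (rule mean_mono[OF mean]) (auto simp: A_def)
    also have "\<dots> \<le> (\<Sum>p\<in>F \<times> F. \<mu> (A p))"
      using F by (intro mean_UN_le[OF mean]) (auto simp: A_def)
    also have "\<dots> = real (card (F \<times> F)) * \<mu> (Comm G)" using A by simp
    finally have "1 \<le> real (card (F \<times> F)) * \<mu> (Comm G)"
      using mean_carrier[OF mean] by simp
    then show "\<mu> (Comm G) > 0"
      by (metis mean_nonneg[OF mean Comm_subset] less_eq_real_def mult_zero_right not_one_le_zero)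
  }
qed

end
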